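(* Let $B=\mathbb{F}_q$, $F=\mathbb{F}_{q^\ell}$ with $\ell>1$, let $\mathcal{A}\subseteq F$ be a $B$-linear subspace with $n=|\mathcal{A}|$, let $\mathcal{B}=\{\beta^{(1)},\dots,\beta^{(\ell)}\}$ be a basis of $F$ over $B$, and let $\chi$ be the canonical additive character of $F$. Let $\{g_j(x)\}_{j=1}^\ell$ be an $(m,t)$-normalized repair scheme with respect to $\mathcal{B}$ for node $i^*$ of ${\rm RS}(\mathcal{A},k)$, where the basis elements are indexed so that $\bigcup_{j=m+1}^{\ell}{\rm supp}(\Phi_{\hat{\mathcal{B}}}(\omega_j))=[t+1,\ell]$ ($\omega_j$ being the constant value of $g_j$ for $j\in[m+1,\ell]$). Then the I/O cost of the scheme with respect to $\mathcal{B}$ is $$\gamma_{I/O}=(n-1)\ell-\frac{1}{q^m}\sum_{s=1}^t\ \sum_{\bm{u}\in B^m}\ \sum_{\alpha\in\mathcal{A}}\chi\big(g_{\bm u}(\alpha)\beta^{(s)}\big),$$ where $g_{\bm u}(x)=\sum_{j=1}^m u_jg_j(x)$ for $\bm{u}=(u_1,\dots,u_m)\in B^m$.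
   Context: Notation: $[n]=\{1,\dots,n\}$, $[a,b]=\{a,a+1,\dots,b\}$. ${\rm Tr}_{F/B}$ is the trace from $F$ to $B$. The canonical additive character of $F$ is $\chi(x)=\zeta_p^{{\rm Tr}(x)}$, where $p={\rm Char}(F)$, $\zeta_p=e^{2\pi\sqrt{-1}/p}$ and ${\rm Tr}$ is the absolute trace $F\to\mathbb{F}_p$. For $\mathcal{A}=\{\alpha_1,\dots,\alpha_n\}\subseteq F$ (distinct elements) and $1\le k<n$, ${\rm RS}(\mathcal{A},k)=\{(f(\alpha_1),\dots,f(\alpha_n)): f\in F[x],\ \deg f\le k-1\}$; coordinate $i$ is called node $i$. When $\mathcal{A}$ is a $B$-linear subspace of $F$, ${\rm RS}(\mathcal{A},k)^\perp={\rm RS}(\mathcal{A},n-k)$. A linear repair scheme (over $B$) for node $i^*$ of ${\rm RS}(\mathcal{A},k)$ is a list of $\ell$ polynomials $g_1,\dots,g_\ell\in F[x]$ of degree less than $n-k$ such that $g_1(\alpha_{i^*}),\dots,g_\ell(\alpha_{i^*})$ are linearly independent over $B$. For $i\in[n]$ let $W_i$ be the $\ell\times\ell$ matrix over $B$ whose $(j,s)$ entry is ${\rm Tr}_{F/B}(g_j(\alpha_i)\beta^{(s)})$. The I/O cost with respect to the basis $\mathcal{B}$ is $\gamma_{I/O}=\sum_{i\in[n]}{\rm nz}(W_i)-\ell=\sum_{i\ne i^*}{\rm nz}(W_i)$, where ${\rm nz}(W)$ is the number of nonzero columns of $W$. For $\omega\in F$, $\Phi_{\hat{\mathcal{B}}}(\omega)=({\rm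 Tr}_{F/B}(\omega\beta^{(1)}),\dots,{\rm Tr}_{F/B}(\omega\beta^{(\ell)}))\in B^\ell$, and ${\rm supp}$ of a vector is the set of indices of its nonzero coordinates. A linear repair scheme $\{g_j\}_{j=1}^\ell$ is $(m,t)$-normalized with respect to $\mathcal{B}$ if: 1) $\deg(g_{\bm u})>0$ for every $\bm{u}\in B^m\setminus\{\bm 0\}$, where $g_{\bm u}=\sum_{j=1}^m u_jg_j$; 2) $g_j(x)=\omega_j$ is a constant for each $j\in[m+1,\ell]$, and $\big|\bigcup_{j=m+1}^{\ell}{\rm supp}(\Phi_{\hat{\mathcal{B}}}(\omega_j))\big|=\ell-t$. *)

theory Defs
  imports Complex_Main
    "HOL-Library.FuncSet"
    "HOL-Library.Cardinality"
    "HOL-Computational_Algebra.Computational_Algebra"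
begin

(* The big field F is the type 'a::finite_field; the base field B is a subset of it.
   Vectors and families indexed by {1..l} are functions on nat, of which only the
   values on {1..l} matter. *)

definition is_subfield :: "'a::field set \<Rightarrow> bool" where
  "is_subfield B \<longleftrightarrow> 0 \<in> B \<and> 1 \<in> B \<and>
     (\<forall>x\<in>B. \<forall>y\<in>B. x - y \<in> B \<and> x * y \<in> B) \<and> (\<forall>x\<in>B. inverse x \<in> B)"

definition is_subspace :: "'a::field set \<Rightarrow> 'a set \<Rightarrow> bool" where
  "is_subspace B V \<longleftrightarrow> 0 \<in> V \<and> (\<forall>x\<in>V. \<forall>y\<in>V. x + y \<in> V) \<and> (\<forall>b\<in>B. \<forall>x\<in>V. b * x \<in> V)"

definition lin_indep :: "'a::field set \<Rightarrow> nat \<Rightarrow> (nat \<Rightarrow> 'a) \<Rightarrow> bool" where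
  "lin_indep B l v \<longleftrightarrow>
     (\<forall>c \<in> {1..l} \<rightarrow> B. (\<Sum>j=1..l. c j * v j) = 0 \<longrightarrow> (\<forall>j\<in>{1..l}. c j = 0))"

definition is_basis :: "'a::field set \<Rightarrow> nat \<Rightarrow> (nat \<Rightarrow> 'a) \<Rightarrow> bool" where
  "is_basis B l \<beta> \<longleftrightarrow> lin_indep B l \<beta> \<and> (\<forall>x. \<exists>c \<in> {1..l} \<rightarrow> B. x = (\<Sum>s=1..l. c s * \<beta> s))"

(* [F : B]; for finite fields it is determined by the cardinalities. *)
definition ext_degree :: "'a::finite_field set \<Rightarrow> nat" where
  "ext_degree B = (THE d. CARD('a) = card B ^ d)"

definition trace_to :: "'a::finite_field set \<Rightarrow> 'a \<Rightarrow> 'a" where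
  "trace_to B x = (\<Sum>i<ext_degree B. x ^ (card B ^ i))"

definition prime_subfield :: "'a::finite_field set" where
  "prime_subfield = range of_nat"

(* The absolute trace lies in the prime subfield, whose elements are the of_nat r with
   r < CHAR('a), each for exactly one r; this r is the exponent of the root of unity. *)
definition canonical_char :: "'a::finite_field \<Rightarrow> complex" where
  "canonical_char x = cis (2 * pi / real CHAR('a)) ^
     (THE r. r < CHAR('a) \<and> of_nat r = trace_to prime_subfield x)"

(* A repair scheme over B for node i of RS(A,k), with A = {\<alpha> 1, ..., \<alpha> n}. *)
definition linear_repair_scheme ::
  "'a::field set \<Rightarrow> nat \<Rightarrow> (nat \<Rightarrow> 'a) \<Rightarrow> nat \<Rightarrow> nat \<Rightarrow> nat \<Rightarrow> (nat \<Rightarrow> 'a poly) \<Rightarrow> bool" where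
  "linear_repair_scheme B n \<alpha> k i l g \<longleftrightarrow>
     (\<forall>j\<in>{1..l}. degree (g j) < n - k) \<and> lin_indep B l (\<lambda>j. poly (g j) (\<alpha> i))"

definition repair_matrix ::
  "'a::finite_field set \<Rightarrow> (nat \<Rightarrow> 'a) \<Rightarrow> (nat \<Rightarrow> 'a) \<Rightarrow> (nat \<Rightarrow> 'a poly) \<Rightarrow> nat \<Rightarrow> nat \<Rightarrow> nat \<Rightarrow> 'a" where
  "repair_matrix B \<alpha> \<beta> g i = (\<lambda>j s. trace_to B (poly (g j) (\<alpha> i) * \<beta> s))"

(* number of nonzero columns of an l x l matrix W (row index first) *)
definition nz :: "nat \<Rightarrow> (nat \<Rightarrow> nat \<Rightarrow> 'a::zero) \<Rightarrow> nat" where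
  "nz l W = card {s \<in> {1..l}. \<exists>j\<in>{1..l}. W j s \<noteq> 0}"

(* Number of symbols read at the helper nodes.  For a repair scheme for node istar the matrix
   of istar has no zero column, so this is also the sum over all nodes, minus l. *)
definition io_cost ::
  "'a::finite_field set \<Rightarrow> nat \<Rightarrow> (nat \<Rightarrow> 'a) \<Rightarrow> nat \<Rightarrow> nat \<Rightarrow> (nat \<Rightarrow> 'a) \<Rightarrow> (nat \<Rightarrow> 'a poly) \<Rightarrow> nat" where
  "io_cost B n \<alpha> istar l \<beta> g = (\<Sum>i \<in> {1..n} - {istar}. nz l (repair_matrix B \<alpha> \<beta> g i))"

definition trace_coords :: "'a::finite_field set \<Rightarrow> (nat \<Rightarrow> 'a) \<Rightarrow> 'a \<Rightarrow> nat \<Rightarrow> 'a" where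
  "trace_coords B \<beta> \<omega> = (\<lambda>s. trace_to B (\<omega> * \<beta> s))"

definition vec_supp :: "nat \<Rightarrow> (nat \<Rightarrow> 'a::zero) \<Rightarrow> nat set" where
  "vec_supp l v = {s \<in> {1..l}. v s \<noteq> 0}"

definition poly_comb :: "nat \<Rightarrow> (nat \<Rightarrow> 'a::field poly) \<Rightarrow> (nat \<Rightarrow> 'a) \<Rightarrow> 'a poly" where
  "poly_comb m g u = (\<Sum>j=1..m. smult (u j) (g j))"

(* The property of a repair scheme g of being (m,t)-normalized; B^m is {1..m} \<rightarrow>\<^sub>E B. *)
definition normalized ::
  "'a::finite_field set \<Rightarrow> nat \<Rightarrow> (nat \<Rightarrow> 'a) \<Rightarrow> nat \<Rightarrow> nat \<Rightarrow> (nat \<Rightarrow> 'a poly) \<Rightarrow> bool" where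
  "normalized B l \<beta> m t g \<longleftrightarrow>
     m \<le> l \<and> t \<le> l \<and>
     (\<forall>u \<in> {1..m} \<rightarrow>\<^sub>E B. (\<exists>j\<in>{1..m}. u j \<noteq> 0) \<longrightarrow> degree (poly_comb m g u) > 0) \<and>
     (\<exists>\<omega>. (\<forall>j\<in>{m+1..l}. g j = [:\<omega> j:]) \<and>
          card (\<Union>j\<in>{m+1..l}. vec_supp l (trace_coords B \<beta> (\<omega> j))) = l - t)"

end

theory Submission
  imports Defs "HOL-Library.Real_Mod" "HOL-Number_Theory.Cong"
begin

text \<open>
  Column \<open>s\<close> of the matrix of node \<open>\<alpha>\<close> is nonzero for \<open>s > t\<close> because of the constant polynomials,
  and for \<open>s \<le> t\<close> it vanishes iff \<open>Tr(g\<^sub>j(\<alpha>) \<beta>\<^sub>s) = 0\<close> for all \<open>j \<le> m\<close>. The character sum over \<open>u \<in> B\<^sup>m\<close>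
  factors into \<open>m\<close> sums \<open>\<Sum>b\<in>B. \<chi>(b y)\<close> with \<open>y = g\<^sub>j(\<alpha>) \<beta>\<^sub>s\<close>; by transitivity of the trace, \<open>b \<mapsto> \<chi>(b y)\<close>
  is a trivial character of \<open>B\<close> iff \<open>Tr(y) = 0\<close>, so the whole sum is \<open>q\<^sup>m\<close> or \<open>0\<close> and counts the zero
  columns. The failed node has none, since the values of the \<open>g\<^sub>j\<close> there span \<open>F\<close> over \<open>B\<close> and the
  trace form is nondegenerate.
\<close>

subsection \<open>Finite subfields and their subspaces\<close>

lemma subfield_add:
  assumes "is_subfield B" "x \<in> B" "y \<in> B"
  shows "x + y \<in> B"
proof -
  have "0 - y \<in> B" using assms by (simp only: is_subfield_def)
  then have "x - (0 - y) \<in> B" using assms by (simp only: is_subfield_def)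
  then show ?thesis by simp
qed

lemma card_subfield_gt_1:
  fixes B :: "'a::finite_field set"
  assumes "is_subfield B"
  shows "card B > 1"
proof -
  have "card {0, 1::'a} \<le> card B"
    using assms by (intro card_mono) (auto simp: is_subfield_def)
  then show ?thesis by simp
qed

text \<open>Lagrange's argument for the multiplicative group: multiplication by a nonzero
  \<open>x\<close> permutes \<open>B - {0}\<close>, so comparing the products of all nonzero
  elements forces \<open>x\<close> to the power \<open>card (B - {0})\<close> to be 1.\<close>

lemma subfield_power_card:
  fixes B :: "'a::finite_field set"
  assumes B: "is_subfield B" and x: "x \<in> B"
  shows "x ^ card B = x"
proof (cases "x = 0")
  case True
  then show ?thesis using card_subfield_gt_1[OF B] by simp
next
  case False
  have mult: "u * v \<in> B" if "u \<in> B" "v \<in> B" for u v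
    using B that by (auto simp: is_subfield_def)
  have inv: "inverse x \<in> B" using B x by (auto simp: is_subfield_def)
  have "0 \<in> B" using B by (auto simp: is_subfield_def)
  then have c: "card B = Suc (card (B - {0}))"
    using card_Suc_Diff1[of B 0] by simp
  have div: "y / x \<in> B" if "y \<in> B" for y
    using mult[OF that inv] by (simp add: divide_inverse)
  have "(\<Prod>y\<in>B-{0}. x * y) = \<Prod>(B-{0})"
    by (rule prod.reindex_bij_witness[of _ "\<lambda>y. y / x" "\<lambda>y. x * y"])
       (use False mult x div in auto)
  then have "x ^ card (B - {0}) * \<Prod>(B-{0}) = \<Prod>(B-{0})"
    by (simp add: prod.distrib)
  then have "x ^ card (B - {0}) = 1" by simp
  then show ?thesis by (simp add: c)
qed

text \<open>Among the subspaces of \<open>V\<close> whose cardinality is a power of \<open>card K\<close>, a largest one is \<open>V\<close>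
  itself: adjoining a further vector would multiply its cardinality by \<open>card K\<close>.\<close>

lemma card_subspace_power:
  fixes K V :: "'a::finite_field set"
  assumes K: "is_subfield K" and V: "is_subspace K V"
  shows "\<exists>d. card V = card K ^ d"
proof -
  define S where "S = {W. is_subspace K W \<and> W \<subseteq> V \<and> (\<exists>d. card W = card K ^ d)}"
  have "{0} \<in> S"
    using V by (auto simp: S_def is_subspace_def intro: exI[of _ 0])
  moreover have "finite S" by simp
  ultimately obtain W where W: "W \<in> S" and max: "\<And>W'. W' \<in> S \<Longrightarrow> card W' \<le> card W"
    using Max_in[of "card ` S"] Max_ge[of "card ` S"]
    by (metis (no_types, lifting) empty_iff finite_imageI image_iff)
  from W have sW: "is_subspace K W" and WV: "W \<subseteq> V" by (auto simp: S_def)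
  from W obtain d where d: "card W = card K ^ d" by (auto simp: S_def)
  have minus: "u - v \<in> W" if "u \<in> W" "v \<in> W" for u v
  proof -
    have "0 - 1 \<in> K" using K by (simp only: is_subfield_def)
    then have "(0 - 1) * v \<in> W" using sW that by (simp only: is_subspace_def)
    then have "u + (0 - 1) * v \<in> W" using sW that by (simp only: is_subspace_def)
    then show ?thesis by simp
  qed
  have "V \<subseteq> W"
  proof
    fix x assume x: "x \<in> V"
    show "x \<in> W"
    proof (rule ccontr)
      assume nx: "x \<notin> W"
      define h where "h = (\<lambda>(c, w). c * x + w)"
      define W' where "W' = h ` (K \<times> W)"
      have inj: "inj_on h (K \<times> W)"
      proof (rule inj_onI, clarify)
        fix c w c' w'
        assume m: "c \<in> K" "w \<in> W" "c' \<in> K" "w' \<in> W" and "h (c, w) = h (c', w')"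
        then have e: "(c - c') * x = w' - w" by (simp add: h_def algebra_simps)
        \<comment> \<open>Two different coefficients would allow division by \<open>c - c'\<close>,
          expressing \<open>x\<close> as an element of \<open>W\<close>.\<close>
        have "c = c'"
        proof (rule ccontr)
          assume ne: "c \<noteq> c'"
          have "inverse (c - c') \<in> K" using K m by (simp add: is_subfield_def)
          then have "inverse (c - c') * (w' - w) \<in> W"
            using sW minus[OF m(4) m(2)] by (simp add: is_subspace_def)
          moreover have "inverse (c - c') * (w' - w) = x"
            using ne by (simp flip: e add: field_simps)
          ultimately show False using nx by simp
        qed
        with e show "c = c' \<and> w = w'" by simp
      qed
      have hI: "c * x + w \<in> W'" if "c \<in> K" "w \<in> W" for c w
        using that unfolding W'_def h_def by force
      have hE: "\<exists>c\<in>K. \<exists>w\<in>W. y = c * x + w" if "y \<in> W'" for y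
        using that unfolding W'_def h_def by auto
      have "is_subspace K W'"
        unfolding is_subspace_def
      proof (intro conjI ballI)
        show "0 \<in> W'"
          using hI[of 0 0] K sW by (simp add: is_subfield_def is_subspace_def)
      next
        fix y z assume "y \<in> W'" "z \<in> W'"
        then obtain c w c' w' where
          "c \<in> K" "w \<in> W" "y = c * x + w" "c' \<in> K" "w' \<in> W" "z = c' * x + w'"
          using hE by blast
        moreover from this have "(c + c') * x + (w + w') \<in> W'"
          using sW by (intro hI subfield_add[OF K]) (simp_all add: is_subspace_def)
        ultimately show "y + z \<in> W'" by (simp add: algebra_simps)
      next
        fix b y assume b: "b \<in> K" and "y \<in> W'"
        then obtain c w where cw: "c \<in> K" "w \<in> W" "y = c * x + w" using hE by blast
        have "(b * c) * x + (b * w) \<in> W'"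
          using cw sW K b by (intro hI) (simp_all add: is_subspace_def is_subfield_def)
        then show "b * y \<in> W'" using cw by (simp add: algebra_simps)
      qed
      moreover have "W' \<subseteq> V"
      proof
        fix y assume "y \<in> W'"
        then obtain c w where "c \<in> K" "w \<in> W" "y = c * x + w" using hE by blast
        then show "y \<in> V" using V WV x by (auto simp: is_subspace_def subset_iff)
      qed
      moreover have card': "card W' = card K * card W"
        using inj by (simp add: W'_def card_image card_cartesian_product)
      moreover have "card K * card W = card K ^ Suc d" by (simp add: d)
      ultimately have "W' \<in> S" unfolding S_def mem_Collect_eq by metis
      then have "card K * card W \<le> 1 * card W" using max card' by force
      moreover have "card W > 0" using sW by (auto simp: is_subspace_def card_gt_0_iff)
      ultimately show False using card_subfield_gt_1[OF K] by simp
    qed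
  qed
  with WV have "W = V" by blast
  with d show ?thesis by blast
qed

text \<open>Independence makes the map from coefficient vectors to linear combinations injective.
  Its domain, taken as extensional functions so that it is finite, has exactly as many elements as
  the field, so the map is also surjective.\<close>

lemma spanning_if_independent:
  fixes B :: "'a::finite_field set"
  assumes B: "is_subfield B" and card: "CARD('a) = card B ^ l" and ind: "lin_indep B l v"
  shows "\<exists>c \<in> {1..l} \<rightarrow> B. x = (\<Sum>j=1..l. c j * v j)"
proof -
  define h where "h = (\<lambda>c. \<Sum>j=1..l. c j * v j)"
  have "inj_on h ({1..l} \<rightarrow>\<^sub>E B)"
  proof (rule inj_onI)
    fix c c' assume c: "c \<in> {1..l} \<rightarrow>\<^sub>E B" and c': "c' \<in> {1..l} \<rightarrow>\<^sub>E B" and "h c = h c'"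
    then have z: "(\<Sum>j=1..l. (c j - c' j) * v j) = 0"
      by (simp add: h_def algebra_simps sum_subtractf)
    have "(\<lambda>j. c j - c' j) \<in> {1..l} \<rightarrow> B"
      using c c' B by (auto simp: is_subfield_def PiE_iff)
    from ind[unfolded lin_indep_def, rule_format, OF this z]
    have "\<forall>j\<in>{1..l}. c j - c' j = 0" by blast
    then show "c = c'" using c c' by (intro PiE_ext[of c "{1..l}" "\<lambda>_. B"]) auto
  qed
  then have "card (h ` ({1..l} \<rightarrow>\<^sub>E B)) = CARD('a)"
    by (simp add: card_image card_funcsetE card)
  then have "h ` ({1..l} \<rightarrow>\<^sub>E B) = UNIV" by (intro card_subset_eq) auto
  then obtain c where "c \<in> {1..l} \<rightarrow>\<^sub>E B" "x = h c" by blast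
  then show ?thesis unfolding h_def by (intro bexI[of _ c]) auto
qed

section \<open>Fixed points of Frobenius powers and the prime subfield\<close>

lemma card_power_eq_self_le:
  assumes "c > 1"
  shows "card {x :: 'a::field. x ^ c = x} \<le> c"
proof -
  let ?P = "monom 1 c - monom 1 1 :: 'a poly"
  have "coeff ?P c = 1" using assms by simp
  then have "?P \<noteq> 0" by (metis coeff_0 zero_neq_one)
  moreover have "degree ?P \<le> c"
    using assms by (intro degree_diff_le) (simp_all add: degree_monom_eq)
  moreover have "{x. poly ?P x = 0} = {x. x ^ c = x}" by (simp add: poly_monom)
  ultimately show ?thesis using card_poly_roots_bound[of ?P] by simp
qed

text \<open>With p the characteristic, the numerals below p are p distinct elements of the prime
  subfield, each fixed by Frobenius, while X^p - X has at most p roots. The two bounds squeeze both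
  sets to size p.\<close>

lemma prime_subfield_eq_Frobenius_fixed:
  "(prime_subfield :: 'a::finite_field set) = {x. x ^ CHAR('a) = x}"
  and card_prime_subfield: "card (prime_subfield :: 'a set) = CHAR('a)"
proof -
  let ?p = "CHAR('a)"
  have p: "prime ?p" by simp
  have sub: "(prime_subfield :: 'a set) \<subseteq> {x. x ^ ?p = x}"
  proof
    fix x :: 'a assume "x \<in> prime_subfield"
    then obtain k where x: "x = of_nat k" by (auto simp: prime_subfield_def)
    have "(of_nat k :: 'a) ^ ?p = of_nat k"
      by (induction k) (simp_all add: freshmans_dream[OF p refl] zero_power)
    then show "x \<in> {x. x ^ ?p = x}" by (simp add: x)
  qed
  have "?p > 1" using p prime_gt_1_nat by blast
  note le = card_power_eq_self_le[where ?'a = 'a, OF this]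
  have "inj_on (of_nat :: nat \<Rightarrow> 'a) {..<?p}"
    by (auto intro!: inj_onI simp: of_nat_eq_iff_cong_CHAR cong_def)
  then have "?p = card ((of_nat :: nat \<Rightarrow> 'a) ` {..<?p})" by (simp add: card_image)
  also have "\<dots> \<le> card (prime_subfield :: 'a set)"
    by (intro card_mono) (auto simp: prime_subfield_def)
  finally have ge: "?p \<le> card (prime_subfield :: 'a set)" .
  show "(prime_subfield :: 'a set) = {x. x ^ CHAR('a) = x}"
    using sub le ge by (intro card_seteq) auto
  with le ge show "card (prime_subfield :: 'a set) = CHAR('a)" by simp
qed

lemma is_subfield_prime_subfield: "is_subfield (prime_subfield :: 'a::finite_field set)"
proof -
  have p: "prime CHAR('a)" by simp
  \<comment> \<open>Additivity of Frobenius applied to (x - y) + y handles differences without a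
    case distinction on the sign of (-1)^p.\<close>
  have diff: "(x - y) ^ CHAR('a) = x - y" if "x ^ CHAR('a) = x" "y ^ CHAR('a) = y" for x y :: 'a
    using freshmans_dream[OF p refl, of "x - y" y] that by (simp add: eq_diff_eq)
  show ?thesis
    unfolding prime_subfield_eq_Frobenius_fixed is_subfield_def
    by (auto simp: zero_power power_mult_distrib power_inverse diff)
qed

text \<open>\<open>B\<close> contains all numerals, hence is a vector space over the prime subfield.
  This makes powers of \<open>card B\<close> iterates of Frobenius, which are additive.\<close>

lemma card_subfield_power_CHAR:
  fixes B :: "'a::finite_field set"
  assumes "is_subfield B"
  obtains f where "card B = CHAR('a) ^ f" "f > 0"
proof -
  have "(of_nat k :: 'a) \<in> B" for k
    using assms by (induction k) (auto simp: is_subfield_def intro!: subfield_add[OF assms])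
  then have "is_subspace prime_subfield B"
    using assms subfield_add[OF assms]
    by (auto simp: is_subspace_def prime_subfield_def is_subfield_def)
  then obtain f where f: "card B = CHAR('a) ^ f"
    using card_subspace_power[OF is_subfield_prime_subfield] card_prime_subfield[where ?'a = 'a]
    by metis
  moreover have "f > 0" using f card_subfield_gt_1[OF assms] by (cases f) auto
  ultimately show ?thesis using that by blast
qed

subsection \<open>Traces\<close>

lemma ext_degree_eq:
  fixes B :: "'a::finite_field set"
  assumes "card B > 1" "CARD('a) = card B ^ l"
  shows "ext_degree B = l"
  unfolding ext_degree_def using assms by (intro the_equality) auto

text \<open>A power sum of this shape is a nonzero polynomial of degree \<open>r ^ (d - 1)\<close>, too small for
  all elements of \<open>S\<close> to be roots.\<close>

lemma exists_power_sum_nonzero: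
  fixes S :: "'a::finite_field set"
  assumes r: "r > 1" and d: "d > 0" and S: "card S = r ^ d"
  shows "\<exists>x\<in>S. (\<Sum>i<d. x ^ (r ^ i)) \<noteq> 0"
proof (rule ccontr)
  assume "\<not> ?thesis"
  then have *: "S \<subseteq> {x. (\<Sum>i<d. x ^ (r ^ i)) = 0}" by auto
  define P :: "'a poly" where "P = (\<Sum>i<d. monom 1 (r ^ i))"
  \<comment> \<open>Since \<open>r > 1\<close> the exponents \<open>r ^ i\<close> are distinct, so
    only the top summand contributes to this coefficient.\<close>
  have "coeff P (r ^ (d - 1)) = (\<Sum>i<d. if i = d - 1 then 1 else 0)"
    using r by (auto simp: P_def coeff_sum intro!: sum.cong)
  also have "\<dots> = 1" using d by (simp add: sum.delta)
  finally have "P \<noteq> 0" by auto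
  then have "card {x. poly P x = 0} \<le> degree P" by (rule card_poly_roots_bound)
  also have "\<dots> \<le> r ^ (d - 1)"
    unfolding P_def using r
    by (intro degree_sum_le) (auto simp: degree_monom_eq intro!: power_increasing)
  also have "\<dots> < r ^ d" using r d by simp
  finally have "card {x. poly P x = 0} < card S" using S by simp
  moreover have "S \<subseteq> {x. poly P x = 0}" using * by (simp add: P_def poly_sum poly_monom)
  then have "card S \<le> card {x. poly P x = 0}" by (intro card_mono) auto
  ultimately show False by simp
qed

text \<open>Transitivity of the trace at the level of power sums: write each exponent index as
  \<open>k = j * f + i\<close> with \<open>i < f\<close>, then pull the Frobenius power belonging to
  \<open>i\<close> out of the sum over \<open>j\<close>.\<close>

lemma power_sum_transitive:
  fixes y :: "'a::finite_field"
  shows "(\<Sum>k<l * f. y ^ (CHAR('a) ^ k)) =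
    (\<Sum>i<f. (\<Sum>j<l. y ^ ((CHAR('a) ^ f) ^ j)) ^ (CHAR('a) ^ i))"
proof -
  let ?p = "CHAR('a)"
  have "(\<Sum>k<l * f. y ^ (?p ^ k)) = (\<Sum>j<l. \<Sum>k=j*f..<j*f+f. y ^ (?p ^ k))"
    by (rule sum.nat_group[symmetric])
  also have "\<dots> = (\<Sum>j<l. \<Sum>i<f. (y ^ ((?p ^ f) ^ j)) ^ (?p ^ i))"
  proof (rule sum.cong[OF refl])
    fix j
    have "(\<Sum>k=j*f..<j*f+f. y ^ (?p ^ k)) = (\<Sum>i<f. y ^ (?p ^ (j * f + i)))"
      by (rule sum.reindex_bij_witness[of _ "\<lambda>i. j * f + i" "\<lambda>k. k - j * f"]) auto
    then show "(\<Sum>k=j*f..<j*f+f. y ^ (?p ^ k)) = (\<Sum>i<f. (y ^ ((?p ^ f) ^ j)) ^ (?p ^ i))"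
      by (simp add: power_add mult.commute flip: power_mult)
  qed
  also have "\<dots> = (\<Sum>i<f. \<Sum>j<l. (y ^ ((?p ^ f) ^ j)) ^ (?p ^ i))" by (rule sum.swap)
  also have "\<dots> = (\<Sum>i<f. (\<Sum>j<l. y ^ ((?p ^ f) ^ j)) ^ (?p ^ i))"
    by (intro sum.cong refl freshmans_dream_sum'[symmetric]) auto
  finally show ?thesis .
qed

lemma trace_to_add:
  fixes B :: "'a::finite_field set"
  assumes "is_subfield B"
  shows "trace_to B (x + y) = trace_to B x + trace_to B y"
proof -
  obtain f where f: "card B = CHAR('a) ^ f" using card_subfield_power_CHAR[OF assms] .
  have "(x + y) ^ (card B ^ i) = x ^ (card B ^ i) + y ^ (card B ^ i)" for i
    by (rule freshmans_dream'[where n = "f * i"]) (simp_all add: f power_mult)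
  then show ?thesis by (simp add: trace_to_def sum.distrib)
qed

lemma trace_to_scale:
  fixes B :: "'a::finite_field set"
  assumes "is_subfield B" "b \<in> B"
  shows "trace_to B (b * x) = b * trace_to B x"
proof -
  have "b ^ (card B ^ i) = b" for i
    by (induction i) (simp_all add: power_mult subfield_power_card[OF assms])
  then show ?thesis by (simp add: trace_to_def power_mult_distrib sum_distrib_left)
qed

lemma trace_to_0:
  assumes "is_subfield B"
  shows "trace_to B 0 = 0"
  using trace_to_add[OF assms, of 0 0] by (metis add_0_right add_cancel_left_right)

lemma trace_to_sum:
  assumes "is_subfield B"
  shows "trace_to B (sum h I) = (\<Sum>i\<in>I. trace_to B (h i))"
  by (induction I rule: infinite_finite_induct) (simp_all add: trace_to_0 trace_to_add assms)

lemma exists_trace_to_nonzero: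
  fixes B :: "'a::finite_field set"
  assumes "is_subfield B" "CARD('a) = card B ^ l" "l > 0"
  shows "\<exists>x. trace_to B x \<noteq> 0"
  using exists_power_sum_nonzero[of "card B" l "UNIV :: 'a set"] assms
    card_subfield_gt_1[OF assms(1)] ext_degree_eq[of B l]
  by (auto simp: trace_to_def)

text \<open>The outer sum is the trace from \<open>B\<close> to the prime subfield. It is written
  out because \<open>trace_to\<close> always starts from the whole field.\<close>

lemma trace_to_in_subfield_transitive:
  fixes B :: "'a::finite_field set"
  assumes B: "is_subfield B" and card: "CARD('a) = card B ^ l" and f: "card B = CHAR('a) ^ f"
  shows "trace_to prime_subfield x = (\<Sum>i<f. trace_to B x ^ (CHAR('a) ^ i))"
proof -
  have "CHAR('a) > 1" by (intro prime_gt_1_nat) simp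
  moreover have "CARD('a) = CHAR('a) ^ (l * f)"
    by (simp add: card f mult.commute flip: power_mult)
  ultimately have "ext_degree (prime_subfield :: 'a set) = l * f"
    using ext_degree_eq[of "prime_subfield :: 'a set" "l * f"] by (simp add: card_prime_subfield)
  moreover have "ext_degree B = l" using card_subfield_gt_1[OF B] card by (rule ext_degree_eq)
  ultimately show ?thesis
    unfolding trace_to_def by (simp add: power_sum_transitive card_prime_subfield f)
qed

text \<open>Raising to the power \<open>card B\<close> shifts the summands of the trace cyclically,
  so the trace is fixed by this map. The fixed points are exactly \<open>B\<close>, since there are
  at most \<open>card B\<close> of them.\<close>

lemma trace_to_in_subfield:
  fixes B :: "'a::finite_field set"
  assumes B: "is_subfield B" and card: "CARD('a) = card B ^ l"
  shows "trace_to B x \<in> B"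
proof -
  have d: "ext_degree B = l" using card_subfield_gt_1[OF B] card by (rule ext_degree_eq)
  obtain f where f: "card B = CHAR('a) ^ f" using card_subfield_power_CHAR[OF B] .
  have "(\<Sum>i<l. x ^ (card B ^ i)) ^ card B = (\<Sum>i<l. (x ^ (card B ^ i)) ^ card B)"
    by (rule freshmans_dream_sum'[OF _ f]) simp
  also have "\<dots> = (\<Sum>i<l. x ^ (card B ^ Suc i))"
    by (simp add: mult.commute flip: power_mult)
  \<comment> \<open>The cycle closes because the new last term is \<open>x ^ CARD('a) = x\<close>,
    the old first term.\<close>
  also have "\<dots> = (\<Sum>i<l. x ^ (card B ^ i))"
    using sum.lessThan_Suc_shift[of "\<lambda>i. x ^ (card B ^ i)" l]
      sum.lessThan_Suc[of "\<lambda>i. x ^ (card B ^ i)" l]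
      finite_field_power_card_eq_same[of x] card
    by simp
  finally have "trace_to B x ^ card B = trace_to B x" by (simp add: trace_to_def d)
  moreover have "B = {x. x ^ card B = x}"
    using card_power_eq_self_le[OF card_subfield_gt_1[OF B]] subfield_power_card[OF B]
    by (intro card_seteq) auto
  ultimately show ?thesis by blast
qed

lemma trace_to_in_prime_subfield:
  "trace_to prime_subfield (x :: 'a::finite_field) \<in> prime_subfield"
proof -
  obtain e where "CARD('a) = CHAR('a) ^ e"
    using card_subfield_power_CHAR[of "UNIV :: 'a set"] by (auto simp: is_subfield_def)
  then show ?thesis
    by (intro trace_to_in_subfield[OF is_subfield_prime_subfield, of e])
       (simp add: card_prime_subfield)
qed

subsection \<open>Character sums\<close>

text \<open>Frees later arguments from the reduced exponent chosen by \<open>THE\<close>: any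
  natural number representing the trace will do, since the root of unity has p-th power 1.\<close>

lemma canonical_char_eq_power:
  fixes x :: "'a::finite_field"
  assumes "of_nat k = trace_to prime_subfield x"
  shows "canonical_char x = cis (2 * pi / real CHAR('a)) ^ k"
proof -
  let ?p = "CHAR('a)" and ?z = "cis (2 * pi / real CHAR('a))"
  have zp: "?z ^ ?p = 1" by (simp add: DeMoivre)
  have "(THE r. r < ?p \<and> of_nat r = trace_to prime_subfield x) = k mod ?p"
    by (rule the_equality)
       (auto simp flip: assms simp: of_nat_eq_iff_cong_CHAR cong_def)
  moreover have "?z ^ k = ?z ^ (k mod ?p)"
  proof -
    have "?z ^ k = ?z ^ (?p * (k div ?p) + k mod ?p)" by simp
    also have "\<dots> = (?z ^ ?p) ^ (k div ?p) * ?z ^ (k mod ?p)"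
      by (simp only: power_add power_mult)
    finally show ?thesis by (simp add: zp)
  qed
  ultimately show ?thesis by (simp add: canonical_char_def)
qed

lemma canonical_char_add:
  fixes x y :: "'a::finite_field"
  shows "canonical_char (x + y) = canonical_char x * canonical_char y"
proof -
  obtain r s where r: "of_nat r = trace_to prime_subfield x"
    and s: "of_nat s = trace_to prime_subfield y"
    using trace_to_in_prime_subfield[of x] trace_to_in_prime_subfield[of y]
    unfolding prime_subfield_def by (metis imageE)
  then have "of_nat (r + s) = trace_to prime_subfield (x + y)"
    by (simp add: trace_to_add[OF is_subfield_prime_subfield])
  then show ?thesis
    using r s by (simp add: canonical_char_eq_power power_add del: of_nat_add)
qed

text \<open>If \<open>r\<close> represents the trace, the value is \<open>cis\<close> at the angle 2
  pi r / p. It equals 1 exactly when p divides \<open>r\<close>, which is the vanishing of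
  \<open>of_nat r\<close> in characteristic p.\<close>

lemma canonical_char_eq_1_iff:
  fixes x :: "'a::finite_field"
  shows "canonical_char x = 1 \<longleftrightarrow> trace_to prime_subfield x = 0"
proof -
  obtain r where r: "of_nat r = trace_to prime_subfield x"
    using trace_to_in_prime_subfield[of x] unfolding prime_subfield_def by (metis imageE)
  have "canonical_char x = cis (real r * (2 * pi / real CHAR('a)))"
    by (simp add: canonical_char_eq_power[OF r] DeMoivre)
  also have "\<dots> = 1 \<longleftrightarrow> (\<exists>n::int. real r = of_int n * real CHAR('a))"
    by (simp add: cis_eq_1_iff field_simps)
  also have "\<dots> \<longleftrightarrow> (\<exists>n::int. int r = n * int CHAR('a))"
    by (intro ex_cong1) (metis of_int_eq_iff of_int_mult of_int_of_nat_eq)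
  also have "\<dots> \<longleftrightarrow> CHAR('a) dvd r"
    by (metis dvd_def int_dvd_int_iff mult.commute)
  also have "\<dots> \<longleftrightarrow> trace_to prime_subfield x = 0"
    by (simp add: of_nat_eq_0_iff_char_dvd flip: r)
  finally show ?thesis .
qed

lemma canonical_char_0: "canonical_char (0 :: 'a::finite_field) = 1"
  by (simp add: canonical_char_eq_1_iff trace_to_0[OF is_subfield_prime_subfield])

lemma canonical_char_sum:
  fixes h :: "'i \<Rightarrow> 'a::finite_field"
  shows "canonical_char (sum h I) = (\<Prod>i\<in>I. canonical_char (h i))"
  by (induction I rule: infinite_finite_induct)
     (simp_all add: canonical_char_0 canonical_char_add)

lemma sum_canonical_char_subfield:
  fixes B :: "'a::finite_field set"
  assumes B: "is_subfield B" and card: "CARD('a) = card B ^ l"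
  shows "(\<Sum>b\<in>B. canonical_char (b * y)) = (if trace_to B y = 0 then of_nat (card B) else 0)"
proof -
  obtain f where f: "card B = CHAR('a) ^ f" "f > 0" using card_subfield_power_CHAR[OF B] .
  have tr: "trace_to prime_subfield (b * y) = (\<Sum>i<f. (b * trace_to B y) ^ (CHAR('a) ^ i))"
    if "b \<in> B" for b
    using that by (simp add: trace_to_in_subfield_transitive[OF B card f(1)] trace_to_scale[OF B])
  show ?thesis
  proof (cases "trace_to B y = 0")
    case True
    have "canonical_char (b * y) = 1" if "b \<in> B" for b
      using tr[OF that] by (simp add: True canonical_char_eq_1_iff power_0_left)
    then show ?thesis by (simp add: True)
  next
    case False
    have "CHAR('a) > 1" by (intro prime_gt_1_nat) simp
    \<comment> \<open>\<open>c\<close> is an element of \<open>B\<close> with nonzero trace to the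
      prime subfield. Rescaling it gives \<open>b0\<close> with
      \<open>b0 * trace_to B y = c\<close>, so the character is nontrivial at
      \<open>b0 * y\<close>.\<close>
    then obtain c where c: "c \<in> B" "(\<Sum>i<f. c ^ (CHAR('a) ^ i)) \<noteq> 0"
      using exists_power_sum_nonzero[of "CHAR('a)" f B] f by blast
    define b0 where "b0 = c * inverse (trace_to B y)"
    have b0: "b0 \<in> B"
      using c B trace_to_in_subfield[OF B card, of y] by (simp add: b0_def is_subfield_def)
    have "b0 * trace_to B y = c" using False by (simp add: b0_def)
    then have ne: "canonical_char (b0 * y) \<noteq> 1"
      using tr[OF b0] c by (simp add: canonical_char_eq_1_iff)
    \<comment> \<open>Translation by \<open>b0\<close> permutes \<open>B\<close> but multiplies the
      sum by a value other than 1, so the sum is zero.\<close>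
    have "(\<Sum>b\<in>B. canonical_char (b * y)) = (\<Sum>b\<in>B. canonical_char ((b0 + b) * y))"
      by (rule sum.reindex_bij_witness[of _ "\<lambda>b. b0 + b" "\<lambda>b. b - b0"])
         (use B b0 subfield_add[OF B] in \<open>auto simp: is_subfield_def\<close>)
    also have "\<dots> = canonical_char (b0 * y) * (\<Sum>b\<in>B. canonical_char (b * y))"
      by (simp add: distrib_right canonical_char_add sum_distrib_left)
    finally show ?thesis using ne False by simp
  qed
qed

lemma sum_canonical_char_vectors:
  fixes B :: "'a::finite_field set"
  assumes B: "is_subfield B" and card: "CARD('a) = card B ^ l"
  shows "(\<Sum>u \<in> {1..m} \<rightarrow>\<^sub>E B. canonical_char (poly (poly_comb m g u) a * y)) =
    (if \<forall>j\<in>{1..m}. trace_to B (poly (g j) a * y) = 0 then of_nat (card B) ^ m else 0)"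
proof -
  have "canonical_char (poly (poly_comb m g u) a * y) =
    (\<Prod>j\<in>{1..m}. canonical_char (u j * (poly (g j) a * y)))" for u
    by (simp add: poly_comb_def poly_sum sum_distrib_right canonical_char_sum mult.assoc)
  then have "(\<Sum>u \<in> {1..m} \<rightarrow>\<^sub>E B. canonical_char (poly (poly_comb m g u) a * y)) =
    (\<Prod>j\<in>{1..m}. \<Sum>b\<in>B. canonical_char (b * (poly (g j) a * y)))"
    by (simp add: prod_sum_PiE)
  also have "\<dots> = (\<Prod>j\<in>{1..m}. if trace_to B (poly (g j) a * y) = 0 then of_nat (card B) else 0)"
    by (simp only: sum_canonical_char_subfield[OF B card])
  also have "\<dots> = (if \<forall>j\<in>{1..m}. trace_to B (poly (g j) a * y) = 0 then of_nat (card B) ^ m else 0)"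
    by auto
  finally show ?thesis .
qed

section \<open>Nondegeneracy of the trace form\<close>

text \<open>The \<open>v j\<close> span the field, hence so do the \<open>v j * y\<close> for
  nonzero \<open>y\<close>. If the trace vanished on all of these, it would vanish
  identically.\<close>

lemma exists_trace_to_nonzero_if_independent:
  fixes B :: "'a::finite_field set"
  assumes B: "is_subfield B" and card: "CARD('a) = card B ^ l" and l: "l > 0"
    and ind: "lin_indep B l v" and y: "y \<noteq> 0"
  shows "\<exists>j\<in>{1..l}. trace_to B (v j * y) \<noteq> 0"
proof (rule ccontr)
  assume "\<not> ?thesis"
  then have z: "trace_to B (v j * y) = 0" if "j \<in> {1..l}" for j using that by blast
  obtain x where x: "trace_to B x \<noteq> 0" using exists_trace_to_nonzero[OF B card l] by blast
  obtain c where c: "c \<in> {1..l} \<rightarrow> B" "x / y = (\<Sum>j=1..l. c j * v j)"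
    using spanning_if_independent[OF B card ind] by blast
  have "x = x / y * y" using y by simp
  also have "\<dots> = (\<Sum>j=1..l. c j * (v j * y))"
    by (simp only: c(2) sum_distrib_right mult.assoc)
  finally have "trace_to B x = (\<Sum>j=1..l. trace_to B (c j * (v j * y)))"
    by (simp only: trace_to_sum[OF B])
  also have "\<dots> = 0"
    using c(1) z by (intro sum.neutral ballI) (subst trace_to_scale[OF B], auto)
  finally show False using x by simp
qed

lemma lin_indep_nonzero:
  assumes B: "is_subfield B" and ind: "lin_indep B l v" and s: "s \<in> {1..l}"
  shows "v s \<noteq> 0"
proof
  assume v: "v s = 0"
  define c where "c = (\<lambda>j. if j = s then 1 else 0 :: 'a)"
  have "c \<in> {1..l} \<rightarrow> B" using B by (auto simp: c_def is_subfield_def)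
  moreover have "(\<Sum>j=1..l. c j * v j) = 0" using v by (intro sum.neutral) (auto simp: c_def)
  ultimately have "c s = 0" using ind s unfolding lin_indep_def by blast
  then show False by (simp add: c_def)
qed

theorem theorem10:
  fixes B A :: "'a::finite_field set"
    and \<alpha> \<beta> \<omega> :: "nat \<Rightarrow> 'a"
    and g :: "nat \<Rightarrow> 'a poly"
    and q l n k m t istar :: nat
  assumes "is_subfield B" and "card B = q" and "CARD('a) = q ^ l" and "l > 1"
    and "is_subspace B A" and "card A = n" and "bij_betw \<alpha> {1..n} A"
    and "1 \<le> k" and "k < n" and "istar \<in> {1..n}"
    and "is_basis B l \<beta>"
    and "linear_repair_scheme B n \<alpha> k istar l g"
    and "normalized B l \<beta> m t g"
    and "\<forall>j\<in>{m+1..l}. g j = [:\<omega> j:]"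
    and "(\<Union>j\<in>{m+1..l}. vec_supp l (trace_coords B \<beta> (\<omega> j))) = {t+1..l}"
  shows "complex_of_nat (io_cost B n \<alpha> istar l \<beta> g) =
    (of_nat n - 1) * of_nat l -
    1 / of_nat q ^ m *
      (\<Sum>s=1..t. \<Sum>u \<in> {1..m} \<rightarrow>\<^sub>E B. \<Sum>a\<in>A. canonical_char (poly (poly_comb m g u) a * \<beta> s))"
proof -
  note B = \<open>is_subfield B\<close>
  have card: "CARD('a) = card B ^ l" using assms(2,3) by simp
  have tl: "t \<le> l" and ml: "m \<le> l" using assms(13) by (auto simp: normalized_def)
  have bij: "bij_betw \<alpha> {1..n} A" by fact
  have star: "istar \<in> {1..n}" by fact
  \<comment> \<open>\<open>Z a\<close> will be the set of zero columns at the evaluation point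
    \<open>a\<close>: columns beyond \<open>t\<close> are never zero, and on columns up to
    \<open>t\<close> the constant polynomials contribute only zeros.\<close>
  define Z where "Z a = {s \<in> {1..t}. \<forall>j\<in>{1..m}. trace_to B (poly (g j) a * \<beta> s) = 0}" for a
  have Zl: "card (Z a) \<le> l" for a
    using card_mono[of "{1..t}" "Z a"] tl by (force simp: Z_def)
  have supp: "(\<exists>j\<in>{m+1..l}. trace_to B (\<omega> j * \<beta> s) \<noteq> 0) \<longleftrightarrow> s \<in> {t+1..l}"
    if "s \<in> {1..l}" for s
    using that unfolding assms(15)[symmetric] by (auto simp: vec_supp_def trace_coords_def)
  have split: "{1..l} = {1..m} \<union> {m+1..l}" using ml by auto
  have zero_iff: "(\<exists>j\<in>{1..l}. trace_to B (poly (g j) a * \<beta> s) \<noteq> 0) \<longleftrightarrow> s \<notin> Z a"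
    if s: "s \<in> {1..l}" for a s
  proof -
    have "(\<exists>j\<in>{m+1..l}. trace_to B (poly (g j) a * \<beta> s) \<noteq> 0) \<longleftrightarrow> s \<in> {t+1..l}"
      using supp[OF s] assms(14) by simp
    then show ?thesis unfolding split bex_Un using s by (auto simp: Z_def)
  qed
  have nz: "nz l (repair_matrix B \<alpha> \<beta> g i) = l - card (Z (\<alpha> i))" for i
  proof -
    have "{s \<in> {1..l}. \<exists>j\<in>{1..l}. repair_matrix B \<alpha> \<beta> g i j s \<noteq> 0} = {1..l} - Z (\<alpha> i)"
      using zero_iff by (auto simp: repair_matrix_def)
    moreover have "Z (\<alpha> i) \<subseteq> {1..l}" using tl by (auto simp: Z_def)
    ultimately show ?thesis unfolding nz_def by (simp add: card_Diff_subset Z_def)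
  qed
  have Zstar: "Z (\<alpha> istar) = {}"
  proof (rule equals0I)
    fix s assume sZ: "s \<in> Z (\<alpha> istar)"
    then have s: "s \<in> {1..l}" using tl by (auto simp: Z_def)
    have "lin_indep B l (\<lambda>j. poly (g j) (\<alpha> istar))"
      using assms(12) by (simp add: linear_repair_scheme_def)
    moreover have "\<beta> s \<noteq> 0" using assms(11) s by (auto simp: is_basis_def lin_indep_nonzero[OF B])
    ultimately have "\<exists>j\<in>{1..l}. trace_to B (poly (g j) (\<alpha> istar) * \<beta> s) \<noteq> 0"
      using exists_trace_to_nonzero_if_independent[OF B card] \<open>l > 1\<close> by simp
    then show False using zero_iff[OF s] sZ by simp
  qed
  have "(\<Sum>s=1..t. \<Sum>u \<in> {1..m} \<rightarrow>\<^sub>E B. \<Sum>a\<in>A. canonical_char (poly (poly_comb m g u) a * \<beta> s))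
    = (\<Sum>s=1..t. \<Sum>a\<in>A. \<Sum>u \<in> {1..m} \<rightarrow>\<^sub>E B. canonical_char (poly (poly_comb m g u) a * \<beta> s))"
    by (intro sum.cong refl sum.swap)
  also have "\<dots> = (\<Sum>a\<in>A. \<Sum>s=1..t. \<Sum>u \<in> {1..m} \<rightarrow>\<^sub>E B.
      canonical_char (poly (poly_comb m g u) a * \<beta> s))"
    by (rule sum.swap)
  also have "\<dots> = (\<Sum>a\<in>A. of_nat q ^ m * of_nat (card (Z a)))"
  proof (rule sum.cong[OF refl])
    fix a
    have "(\<Sum>s=1..t. \<Sum>u \<in> {1..m} \<rightarrow>\<^sub>E B. canonical_char (poly (poly_comb m g u) a * \<beta> s)) =
      (\<Sum>s=1..t. if \<forall>j\<in>{1..m}. trace_to B (poly (g j) a * \<beta> s) = 0 then of_nat q ^ m else 0)"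
      by (simp only: sum_canonical_char_vectors[OF B card] \<open>card B = q\<close>)
    also have "\<dots> = (\<Sum>s\<in>Z a. of_nat q ^ m)"
      unfolding Z_def by (rule sum.inter_filter[symmetric]) simp
    also have "\<dots> = of_nat q ^ m * of_nat (card (Z a))" by simp
    finally show "(\<Sum>s=1..t. \<Sum>u \<in> {1..m} \<rightarrow>\<^sub>E B.
      canonical_char (poly (poly_comb m g u) a * \<beta> s)) = of_nat q ^ m * of_nat (card (Z a))" .
  qed
  also have "\<dots> = of_nat q ^ m * (\<Sum>a\<in>A. of_nat (card (Z a)))"
    by (simp add: sum_distrib_left)
  also have "(\<Sum>a\<in>A. of_nat (card (Z a))) = (\<Sum>i=1..n. complex_of_nat (card (Z (\<alpha> i))))"
    by (rule sum.reindex_bij_betw[OF bij, symmetric])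
  also have "\<dots> = (\<Sum>i\<in>{1..n} - {istar}. of_nat (card (Z (\<alpha> i))))"
    by (subst sum.remove[OF _ star]) (simp_all add: Zstar)
  finally have char_sum: "(\<Sum>s=1..t. \<Sum>u \<in> {1..m} \<rightarrow>\<^sub>E B. \<Sum>a\<in>A.
      canonical_char (poly (poly_comb m g u) a * \<beta> s)) =
    of_nat q ^ m * (\<Sum>i\<in>{1..n} - {istar}. of_nat (card (Z (\<alpha> i))))" .
  have "q > 0" using card_subfield_gt_1[OF B] assms(2) by simp
  \<comment> \<open>The bound \<open>Zl\<close> turns the truncated subtraction on naturals into a
    genuine one over the complex numbers.\<close>
  have "complex_of_nat (io_cost B n \<alpha> istar l \<beta> g) =
    (\<Sum>i\<in>{1..n} - {istar}. of_nat l - of_nat (card (Z (\<alpha> i))))"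
    by (simp add: io_cost_def nz of_nat_diff Zl)
  also have "\<dots> = (of_nat n - 1) * of_nat l - (\<Sum>i\<in>{1..n} - {istar}. of_nat (card (Z (\<alpha> i))))"
    using star by (simp add: sum_subtractf card_Diff_singleton of_nat_diff)
  finally show ?thesis unfolding char_sum using \<open>q > 0\<close> by simp
qed

end
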